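(* Consider the system $\dot{x}(t)=f(x(t),u(t))$ with inputs $u\in\mathcal{U}^+$. Let $\mathcal{X}_0\subset\mathbb{R}^{n_x}$ be a compact set of initial conditions. If the inputs are equibounded (there exists $M_u>0$ such that $\|u(t)\|\le M_u$ for all $u\in\mathcal{U}^+$ and $t\ge 0$) and the system is globally $\delta$ISS, then the system has input-to-state fading memory (FM) on $\mathcal{X}_0$.
   Context: Setting: $x(t)\in\mathbb{R}^{n_x}$ is the state, $u\in\mathcal{U}^+\subset L_\infty([0,+\infty),\mathbb{R}^{n_u})$ is the input. The system is assumed forward complete: for every considered initial condition and every $u\in\mathcal{U}^+$, the state trajectory is uniquely defined on $[0,+\infty)$. Comparison functions: $\alpha:[0,+\infty)\to[0,+\infty)$ is of class $\mathcal{K}$ if it is continuous, strictly increasing and $\alpha(0)=0$; it is of class $\mathcal{K}_\infty$ if moreover $\lim_{r\to\infty}\alpha(r)=+\infty$. $\beta:[0,+\infty)\times[0,+\infty)\to[0,+\infty)$ is of class $\mathcal{KL}$ if it is continuous, $\beta(\cdot,s)\in\mathcal{K}$ for each $s$, and for each $r$, $\beta(r,\cdot)$ is nonincreasing with $\lim_{s\to+\infty}\beta(r,s)=0$. $\delta$ISS: the system is $\delta$ISS on a set $\mathcal{X}_0$ if there exist $\beta\in\mathcal{KL}$ and $\gamma\in\mathcal{K}_\infty$ such that for any initial conditions $x_a(0),x_b(0)\in\mathcal{X}_0$ and any inputs $u_a,u_b\in\mathcal{U}^+$, the corresponding state trajectories satisfy for all $t\ge0$ $$\|x_a(t)-x_b(t)\|\le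 \beta(\|x_a(0)-x_b(0)\|,t)+\gamma\big(\operatorname{ess\,sup}_{s\in[0,t]}\|u_a(s)-u_b(s)\|\big).$$ It is globally $\delta$ISS if this holds with $\mathcal{X}_0=\mathbb{R}^{n_x}$. Memory kernel: a function $w:[0,+\infty)\to[0,1]$ that is continuous, nonincreasing, and satisfies $\lim_{\Delta t\to+\infty}w(\Delta t)=0$. Input-to-state FM on $\mathcal{X}_0$: there exist $\beta\in\mathcal{KL}$, $\gamma\in\mathcal{K}_\infty$ and a memory kernel $w$ such that for any $x_a(0),x_b(0)\in\mathcal{X}_0$ and any $u_a,u_b\in\mathcal{U}^+$, the corresponding state trajectories satisfy for all $t\ge0$ $$\|x_a(t)-x_b(t)\|\le \beta(\|x_a(0)-x_b(0)\|,t)+\gamma\big(\operatorname{ess\,sup}_{s\in[0,t]}w(t-s)\|u_a(s)-u_b(s)\|\big).$$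
   Formalization: The input class is additionally assumed closed under time shifts (the remainder of an admissible input after any time, restarted at 0, is again admissible); for an arbitrary set of inputs the claim is false. *)

theory Defs
  imports "HOL-Analysis.Analysis" "HOL-Probability.Essential_Supremum"
begin

text \<open>
  Signals on the half-line are total functions on \<^typ>\<open>real\<close>; every notion below only looks at
  their values on \<^term>\<open>{0::real..}\<close>.
\<close>

subsection \<open>Comparison functions and memory kernels\<close>

definition class_K :: "(real \<Rightarrow> real) \<Rightarrow> bool" where
  "class_K \<alpha> \<longleftrightarrow> continuous_on {0..} \<alpha> \<and> strict_mono_on {0..} \<alpha> \<and> \<alpha> 0 = 0"

definition class_K_infinity :: "(real \<Rightarrow> real) \<Rightarrow> bool" where
  "class_K_infinity \<alpha> \<longleftrightarrow> class_K \<alpha> \<and> filterlim \<alpha> at_top at_top"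

definition class_KL :: "(real \<Rightarrow> real \<Rightarrow> real) \<Rightarrow> bool" where
  "class_KL \<beta> \<longleftrightarrow>
     continuous_on ({0..} \<times> {0..}) (\<lambda>(r, s). \<beta> r s) \<and>
     (\<forall>s\<ge>0. class_K (\<lambda>r. \<beta> r s)) \<and>
     (\<forall>r\<ge>0. antimono_on {0..} (\<beta> r) \<and> (\<beta> r \<longlongrightarrow> 0) at_top)"

definition memory_kernel :: "(real \<Rightarrow> real) \<Rightarrow> bool" where
  "memory_kernel w \<longleftrightarrow>
     w ` {0..} \<subseteq> {0..1} \<and> continuous_on {0..} w \<and> antimono_on {0..} w \<and> (w \<longlongrightarrow> 0) at_top"

subsection \<open>Inputs\<close>

text \<open>
  Essential suprema of norms are taken in \<^typ>\<open>ennreal\<close>, so that the essential supremum over the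
  null set \<open>{0..0}\<close> is \<open>0\<close>. Since \<^const>\<open>enn2real\<close> sends \<open>\<infinity>\<close> to \<open>0\<close>, \<open>ess_sup_on\<close> is meaningful
  only for measurable, essentially bounded functions; on \<open>L_infinity\<close> inputs it always is.
\<close>

definition L_infinity :: "(real \<Rightarrow> real ^ 'm) set" where
  "L_infinity = {u \<in> borel_measurable (lebesgue_on {0..}).
     esssup (lebesgue_on {0..}) (\<lambda>s. ennreal (norm (u s))) < \<infinity>}"

definition ess_sup_on :: "real set \<Rightarrow> (real \<Rightarrow> real) \<Rightarrow> real" where
  "ess_sup_on S g = enn2real (esssup (lebesgue_on S) (\<lambda>s. ennreal (g s)))"

text \<open>
  The usual requirement on the input class of a time-invariant system: what remains of an
  admissible input after any time \<open>\<tau>\<close>, with the clock restarted at \<open>0\<close>, is again admissible.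
\<close>

definition shift_closed :: "(real \<Rightarrow> 'b) set \<Rightarrow> bool" where
  "shift_closed U \<longleftrightarrow> (\<forall>u\<in>U. \<forall>\<tau>\<ge>0. \<exists>v\<in>U. \<forall>s\<ge>0. v s = u (\<tau> + s))"

subsection \<open>State trajectories\<close>

definition absolutely_continuous_fun_on :: "real set \<Rightarrow> (real \<Rightarrow> 'a::real_normed_vector) \<Rightarrow> bool" where
  "absolutely_continuous_fun_on S x \<longleftrightarrow>
     (\<forall>\<epsilon>>0. \<exists>\<delta>>0. \<forall>(n::nat) a b.
        (\<forall>i<n. a i \<le> b i \<and> {a i..b i} \<subseteq> S) \<and>
        disjoint_family_on (\<lambda>i. {a i<..<b i}) {..<n} \<and>
        (\<Sum>i<n. b i - a i) < \<delta> \<longrightarrow>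
        (\<Sum>i<n. norm (x (b i) - x (a i))) < \<epsilon>)"

text \<open>
  Inputs are only measurable, so solutions of \<open>x' = f(x, u)\<close> are understood in the sense of
  Caratheodory.
\<close>

definition state_trajectory ::
    "(real ^ 'n \<Rightarrow> real ^ 'm \<Rightarrow> real ^ 'n) \<Rightarrow> (real \<Rightarrow> real ^ 'm) \<Rightarrow> (real \<Rightarrow> real ^ 'n) \<Rightarrow> bool" where
  "state_trajectory f u x \<longleftrightarrow>
     (\<forall>T\<ge>0. absolutely_continuous_fun_on {0..T} x) \<and>
     (AE t in lebesgue_on {0..}. (x has_vector_derivative f (x t) (u t)) (at t within {0..}))"

definition forward_complete ::
    "(real ^ 'n \<Rightarrow> real ^ 'm \<Rightarrow> real ^ 'n) \<Rightarrow> (real \<Rightarrow> real ^ 'm) set \<Rightarrow> bool" where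
  "forward_complete f U \<longleftrightarrow>
     (\<forall>\<xi>. \<forall>u\<in>U. \<exists>x. state_trajectory f u x \<and> x 0 = \<xi> \<and>
        (\<forall>y. state_trajectory f u y \<and> y 0 = \<xi> \<longrightarrow> (\<forall>t\<ge>0. y t = x t)))"

subsection \<open>Incremental input-to-state stability and fading memory\<close>

definition delta_ISS ::
    "(real ^ 'n \<Rightarrow> real ^ 'm \<Rightarrow> real ^ 'n) \<Rightarrow> (real \<Rightarrow> real ^ 'm) set \<Rightarrow> (real ^ 'n) set \<Rightarrow> bool" where
  "delta_ISS f U X0 \<longleftrightarrow>
     (\<exists>\<beta> \<gamma>. class_KL \<beta> \<and> class_K_infinity \<gamma> \<and>
       (\<forall>ua\<in>U. \<forall>ub\<in>U. \<forall>xa xb.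
          state_trajectory f ua xa \<and> state_trajectory f ub xb \<and> xa 0 \<in> X0 \<and> xb 0 \<in> X0 \<longrightarrow>
          (\<forall>t\<ge>0. norm (xa t - xb t)
             \<le> \<beta> (norm (xa 0 - xb 0)) t + \<gamma> (ess_sup_on {0..t} (\<lambda>s. norm (ua s - ub s))))))"

definition globally_delta_ISS ::
    "(real ^ 'n \<Rightarrow> real ^ 'm \<Rightarrow> real ^ 'n) \<Rightarrow> (real \<Rightarrow> real ^ 'm) set \<Rightarrow> bool" where
  "globally_delta_ISS f U \<longleftrightarrow> delta_ISS f U UNIV"

definition input_to_state_FM ::
    "(real ^ 'n \<Rightarrow> real ^ 'm \<Rightarrow> real ^ 'n) \<Rightarrow> (real \<Rightarrow> real ^ 'm) set \<Rightarrow> (real ^ 'n) set \<Rightarrow> bool" where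
  "input_to_state_FM f U X0 \<longleftrightarrow>
     (\<exists>\<beta> \<gamma> w. class_KL \<beta> \<and> class_K_infinity \<gamma> \<and> memory_kernel w \<and>
       (\<forall>ua\<in>U. \<forall>ub\<in>U. \<forall>xa xb.
          state_trajectory f ua xa \<and> state_trajectory f ub xb \<and> xa 0 \<in> X0 \<and> xb 0 \<in> X0 \<longrightarrow>
          (\<forall>t\<ge>0. norm (xa t - xb t)
             \<le> \<beta> (norm (xa 0 - xb 0)) t
               + \<gamma> (ess_sup_on {0..t} (\<lambda>s. w (t - s) * norm (ua s - ub s))))))"

end

theory Submission
  imports Defs
begin

text \<open>
  Restarting the clock at time \<open>t - h\<close> (the input class is closed under shifts) and applying
  \<open>\<delta>\<close>ISS there bounds the state difference at time \<open>t\<close> by \<open>\<beta> R h + \<gamma> E\<close>, where \<open>R\<close> is a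
  uniform bound on the state difference and \<open>E\<close> is the essential supremum of the input difference
  over \<open>{t - h..t}\<close>. With the kernel \<open>w h = exp (- h)\<close> and the weighted supremum \<open>V\<close>, one has
  \<open>E \<le> V / w h\<close>, which is at most \<open>sqrt V\<close> as long as \<open>w h \<ge> sqrt V\<close>; for \<open>h = 0\<close> one has \<open>E = 0\<close>
  whatever \<open>V\<close> is. If \<open>w t \<ge> sqrt V\<close>, take \<open>h = t\<close>, and otherwise \<open>h = max 0 (- ln V / 2)\<close>. This
  gives the original \<open>\<beta>\<close> and the gain \<open>V \<mapsto> \<gamma> (sqrt V) + \<beta> R (max 0 (- ln V / 2))\<close>, which tends
  to \<open>0\<close> with \<open>V\<close> because \<open>\<beta> R\<close> vanishes at infinity.
\<close>

subsection \<open>Comparison functions\<close>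

lemma class_K_mono: "class_K \<alpha> \<Longrightarrow> 0 \<le> a \<Longrightarrow> a \<le> b \<Longrightarrow> \<alpha> a \<le> \<alpha> b"
  unfolding class_K_def by (auto intro: strict_mono_on_leD)

lemma class_K_nonneg: "class_K \<alpha> \<Longrightarrow> 0 \<le> a \<Longrightarrow> 0 \<le> \<alpha> a"
  using class_K_mono[of \<alpha> 0 a] by (simp add: class_K_def)

lemma class_KL_mono: "class_KL \<beta> \<Longrightarrow> 0 \<le> s \<Longrightarrow> 0 \<le> a \<Longrightarrow> a \<le> b \<Longrightarrow> \<beta> a s \<le> \<beta> b s"
  using class_K_mono[of "\<lambda>r. \<beta> r s"] by (simp add: class_KL_def)

lemma class_KL_nonneg: "class_KL \<beta> \<Longrightarrow> 0 \<le> r \<Longrightarrow> 0 \<le> s \<Longrightarrow> 0 \<le> \<beta> r s"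
  using class_K_nonneg[of "\<lambda>r. \<beta> r s"] by (simp add: class_KL_def)

lemma class_KL_antimono: "class_KL \<beta> \<Longrightarrow> 0 \<le> r \<Longrightarrow> 0 \<le> s \<Longrightarrow> s \<le> t \<Longrightarrow> \<beta> r t \<le> \<beta> r s"
  by (auto simp: class_KL_def monotone_on_def)

lemma class_KL_continuous_snd:
  assumes "class_KL \<beta>" "0 \<le> r"
  shows "continuous_on {0..} (\<beta> r)"
proof -
  have "continuous_on ({0..} \<times> {0..}) (\<lambda>(r, s). \<beta> r s)"
    using assms by (simp add: class_KL_def)
  then have "continuous_on {0..} (\<lambda>s. (\<lambda>(r, s). \<beta> r s) (r, s))"
    by (rule continuous_on_compose2) (use assms in \<open>auto intro!: continuous_intros\<close>)
  then show ?thesis by simp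
qed

text \<open>This is the gain of the fading memory estimate. The first summand supplies strict growth
  and unboundedness, so the second need only be nonnegative, nondecreasing and continuous. Its value
  at 0 is prescribed separately as the limit: \<open>- ln v\<close> grows without bound as v
  decreases to 0, and \<open>\<beta> R\<close> vanishes at infinity.\<close>

lemma class_K_infinity_sqrt_plus_KL:
  assumes \<gamma>: "class_K_infinity \<gamma>" and \<beta>: "class_KL \<beta>" and R: "0 \<le> R"
  shows "class_K_infinity
    (\<lambda>v. \<gamma> (sqrt v) + (if v = 0 then 0 else \<beta> R (max 0 (- ln v / 2))))"
    (is "class_K_infinity (\<lambda>v. \<gamma> (sqrt v) + ?g v)")
proof -
  have K: "class_K \<gamma>" and lim: "filterlim \<gamma> at_top at_top"
    using \<gamma> by (auto simp: class_K_infinity_def)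
  have g_nonneg: "0 \<le> ?g v" for v
    using class_KL_nonneg[OF \<beta> R] by simp
  have g_mono: "?g a \<le> ?g b" if "0 \<le> a" "a \<le> b" for a b
  proof (cases "a = 0")
    case True
    then show ?thesis using g_nonneg[of b] by simp
  next
    case False
    then have "ln a \<le> ln b" using that by simp
    then have "max 0 (- ln b / 2) \<le> max 0 (- ln a / 2)" by linarith
    then show ?thesis using False that class_KL_antimono[OF \<beta> R] by simp
  qed
  have g_cont: "continuous_on {0..} ?g"
    unfolding continuous_on_eq_continuous_within
  proof
    fix v :: real assume v: "v \<in> {0..}"
    show "continuous (at v within {0..}) ?g"
    proof (cases "v = 0")
      case True
      have "filterlim (\<lambda>v::real. - ln v) at_top (at_right 0)"
        using filterlim_uminus_at_top_at_bot ln_at_0 by (rule filterlim_compose)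
      then have "filterlim (\<lambda>v::real. 1 / 2 * - ln v) at_top (at_right 0)"
        by (intro filterlim_tendsto_pos_mult_at_top[OF tendsto_const]) auto
      then have "filterlim (\<lambda>v::real. max 0 (- ln v / 2)) at_top (at_right 0)"
        by (rule filterlim_at_top_mono) (simp add: eventually_at_filter)
      moreover have "(\<beta> R \<longlongrightarrow> 0) at_top"
        using \<beta> R by (simp add: class_KL_def)
      ultimately have "((\<lambda>v. \<beta> R (max 0 (- ln v / 2))) \<longlongrightarrow> 0) (at_right 0)"
        using filterlim_compose by blast
      then have "(?g \<longlongrightarrow> 0) (at_right 0)"
        by (rule Lim_transform_eventually) (auto simp: eventually_at_filter)
      \<comment> \<open>Continuity at the endpoint is one-sided, so the right-hand limit settles
        it.\<close>
      moreover have "at 0 within {0..} = at_right (0::real)"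
        by (rule at_within_nhd[of _ UNIV]) auto
      ultimately show ?thesis
        using True by (simp add: continuous_within)
    next
      case False
      have "continuous_on {0<..} (\<lambda>v. \<beta> R (max 0 (- ln v / 2)))"
        by (rule continuous_on_compose2[OF class_KL_continuous_snd[OF \<beta> R]])
          (auto intro!: continuous_intros)
      then have "continuous_on {0<..} ?g"
        by (rule continuous_on_eq) auto
      then have "isCont ?g v"
        using False v by (simp add: continuous_on_eq_continuous_at)
      then show ?thesis by (rule continuous_at_imp_continuous_at_within)
    qed
  qed
  have \<gamma>_cont: "continuous_on {0..} (\<lambda>v. \<gamma> (sqrt v))"
    by (rule continuous_on_compose2[of "{0..}" \<gamma>])
      (use K in \<open>auto simp: class_K_def intro!: continuous_intros\<close>)
  have "class_K (\<lambda>v. \<gamma> (sqrt v) + ?g v)"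
    unfolding class_K_def
  proof (intro conjI)
    show "continuous_on {0..} (\<lambda>v. \<gamma> (sqrt v) + ?g v)"
      using \<gamma>_cont g_cont by (rule continuous_on_add)
    show "strict_mono_on {0..} (\<lambda>v. \<gamma> (sqrt v) + ?g v)"
    proof (rule strict_mono_onI)
      fix a b :: real assume ab: "a \<in> {0..}" "b \<in> {0..}" "a < b"
      then have "\<gamma> (sqrt a) < \<gamma> (sqrt b)"
        using K by (auto simp: class_K_def intro: strict_mono_onD)
      then show "\<gamma> (sqrt a) + ?g a < \<gamma> (sqrt b) + ?g b"
        using g_mono[of a b] ab by auto
    qed
    show "\<gamma> (sqrt 0) + ?g 0 = 0"
      using K by (simp add: class_K_def)
  qed
  moreover have "filterlim (\<lambda>v. \<gamma> (sqrt v) + ?g v) at_top at_top"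
  proof (rule filterlim_at_top_mono)
    show "filterlim (\<lambda>v. \<gamma> (sqrt v)) at_top at_top"
      using lim sqrt_at_top by (rule filterlim_compose)
    show "\<forall>\<^sub>F v in at_top. \<gamma> (sqrt v) \<le> \<gamma> (sqrt v) + ?g v"
      using g_nonneg by simp
  qed
  ultimately show ?thesis
    by (simp add: class_K_infinity_def)
qed

lemma memory_kernel_exp: "memory_kernel (\<lambda>h. exp (- h))"
  unfolding memory_kernel_def
proof (intro conjI)
  show "((\<lambda>h::real. exp (- h)) \<longlongrightarrow> 0) at_top"
    using exp_at_bot filterlim_uminus_at_bot_at_top by (rule filterlim_compose)
qed (auto intro!: continuous_intros simp: monotone_on_def)

subsection \<open>Essential suprema\<close>

lemma ess_sup_on_nonneg: "0 \<le> ess_sup_on S g"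
  by (simp add: ess_sup_on_def)

lemma ess_sup_on_le:
  assumes "g \<in> borel_measurable (lebesgue_on S)" "AE s in lebesgue_on S. g s \<le> c" "0 \<le> c"
  shows "ess_sup_on S g \<le> c"
proof -
  have "esssup (lebesgue_on S) (\<lambda>s. ennreal (g s)) \<le> ennreal c"
    using assms by (intro esssup_I) (auto intro: ennreal_leI)
  then show ?thesis
    using assms(3) by (simp add: ess_sup_on_def enn2real_leI)
qed

text \<open>The bound \<open>c\<close> only guarantees finiteness. \<open>enn2real\<close> sends
  infinity to 0, so the real-valued supremum dominates the function once the \<open>ennreal\<close>
  one is known to be finite.\<close>

lemma AE_le_ess_sup_on:
  assumes "g \<in> borel_measurable (lebesgue_on S)" "AE s in lebesgue_on S. g s \<le> c"
  shows "AE s in lebesgue_on S. g s \<le> ess_sup_on S g"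
proof -
  have "esssup (lebesgue_on S) (\<lambda>s. ennreal (g s)) \<le> ennreal c"
    using assms by (intro esssup_I) (auto intro: ennreal_leI)
  then have "esssup (lebesgue_on S) (\<lambda>s. ennreal (g s)) = ennreal (ess_sup_on S g)"
    using le_less_trans[OF _ ennreal_less_top] by (auto simp: ess_sup_on_def)
  moreover have "AE s in lebesgue_on S. ennreal (g s) \<le> esssup (lebesgue_on S) (\<lambda>s. ennreal (g s))"
    by (rule esssup_AE)
  ultimately show ?thesis
    by (simp add: ess_sup_on_nonneg)
qed

subsection \<open>Time shifts\<close>

text \<open>Translations preserve Lebesgue null sets.\<close>

lemma AE_lebesgue_translate:
  fixes P :: "real \<Rightarrow> bool"
  assumes "AE x in lebesgue. P x"
  shows "AE x in lebesgue. P (c + x)"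
proof -
  obtain N where N: "N \<in> null_sets lebesgue" "{x. \<not> P x} \<subseteq> N"
    using assms by (auto simp: eventually_ae_filter)
  then have "negligible ((+) (- c) ` N)"
    by (intro negligible_translation) (simp add: negligible_iff_null_sets)
  moreover have "{x. \<not> P (c + x)} \<subseteq> (+) (- c) ` N"
  proof
    fix x assume "x \<in> {x. \<not> P (c + x)}"
    then have "c + x \<in> N" "x = - c + (c + x)" using N by auto
    then show "x \<in> (+) (- c) ` N" by (rule rev_image_eqI)
  qed
  ultimately show ?thesis
    by (auto simp: eventually_ae_filter negligible_iff_null_sets)
qed

lemma AE_lebesgue_on_translate:
  fixes P :: "real \<Rightarrow> bool"
  assumes "AE x in lebesgue_on S. P x" "S \<in> sets lebesgue" "T \<in> sets lebesgue"
    and "\<And>x. x \<in> T \<Longrightarrow> c + x \<in> S"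
  shows "AE x in lebesgue_on T. P (c + x)"
proof -
  have "AE x in lebesgue. x \<in> S \<longrightarrow> P x"
    using assms by (simp add: AE_restrict_space_iff)
  then have "AE x in lebesgue. c + x \<in> S \<longrightarrow> P (c + x)"
    by (rule AE_lebesgue_translate)
  then have "AE x in lebesgue. x \<in> T \<longrightarrow> P (c + x)"
    by eventually_elim (use assms(4) in blast)
  then show ?thesis
    using assms by (simp add: AE_restrict_space_iff)
qed

text \<open>Translating a family of intervals keeps lengths and disjointness, so the same \<delta>
  serves for the shifted function.\<close>

lemma absolutely_continuous_fun_on_shift:
  assumes "absolutely_continuous_fun_on S x" "\<And>t. t \<in> T \<Longrightarrow> c + t \<in> S"
  shows "absolutely_continuous_fun_on T (\<lambda>t::real. x (c + t))"
  unfolding absolutely_continuous_fun_on_def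
proof (intro allI impI)
  fix \<epsilon> :: real assume "\<epsilon> > 0"
  then obtain \<delta> where \<delta>: "\<delta> > 0"
    "\<And>(n::nat) a b. (\<forall>i<n. a i \<le> b i \<and> {a i..b i} \<subseteq> S) \<and>
        disjoint_family_on (\<lambda>i. {a i<..<b i}) {..<n} \<and>
        (\<Sum>i<n. b i - a i) < \<delta> \<Longrightarrow> (\<Sum>i<n. norm (x (b i) - x (a i))) < \<epsilon>"
    using assms(1) unfolding absolutely_continuous_fun_on_def by meson
  have "(\<Sum>i<n. norm (x (c + b i) - x (c + a i))) < \<epsilon>"
    if H: "(\<forall>i<n. a i \<le> b i \<and> {a i..b i} \<subseteq> T) \<and>
        disjoint_family_on (\<lambda>i. {a i<..<b i}) {..<n} \<and> (\<Sum>i<n. b i - a i) < \<delta>"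
    for n :: nat and a b
  proof (rule \<delta>(2)[of n "\<lambda>i. c + a i" "\<lambda>i. c + b i"], intro conjI allI impI)
    fix i assume "i < n"
    then show "c + a i \<le> c + b i" using H by simp
    show "{c + a i..c + b i} \<subseteq> S"
    proof
      fix s assume "s \<in> {c + a i..c + b i}"
      then have "s - c \<in> T" using H \<open>i < n\<close> by force
      then show "s \<in> S" using assms(2)[of "s - c"] by simp
    qed
  next
    show "disjoint_family_on (\<lambda>i. {c + a i<..<c + b i}) {..<n}"
      unfolding disjoint_family_on_def
    proof (intro ballI impI)
      fix i j assume "i \<in> {..<n}" "j \<in> {..<n}" "i \<noteq> j"
      then have disj: "{a i<..<b i} \<inter> {a j<..<b j} = {}"
        using H by (simp add: disjoint_family_on_def)
      have "s - c \<in> {a i<..<b i} \<inter> {a j<..<b j}"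
        if "s \<in> {c + a i<..<c + b i} \<inter> {c + a j<..<c + b j}" for s
        using that by auto
      then show "{c + a i<..<c + b i} \<inter> {c + a j<..<c + b j} = {}"
        using disj by blast
    qed
  next
    show "(\<Sum>i<n. c + b i - (c + a i)) < \<delta>" using H by simp
  qed
  then show "\<exists>\<delta>>0. \<forall>(n::nat) a b. (\<forall>i<n. a i \<le> b i \<and> {a i..b i} \<subseteq> T) \<and>
        disjoint_family_on (\<lambda>i. {a i<..<b i}) {..<n} \<and> (\<Sum>i<n. b i - a i) < \<delta> \<longrightarrow>
        (\<Sum>i<n. norm (x (c + b i) - x (c + a i))) < \<epsilon>"
    using \<delta>(1) by blast
qed

text \<open>The vector field does not depend explicitly on time, so restarting the clock turns a
  solution into a solution for the shifted input.\<close>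

lemma state_trajectory_shift:
  assumes x: "state_trajectory f u x" and \<tau>: "0 \<le> \<tau>" and v: "\<And>s. 0 \<le> s \<Longrightarrow> v s = u (\<tau> + s)"
  shows "state_trajectory f v (\<lambda>s. x (\<tau> + s))"
  unfolding state_trajectory_def
proof (intro conjI allI impI)
  fix T :: real assume "0 \<le> T"
  then have "absolutely_continuous_fun_on {0..\<tau> + T} x"
    using x \<tau> by (simp add: state_trajectory_def)
  then show "absolutely_continuous_fun_on {0..T} (\<lambda>s. x (\<tau> + s))"
    by (rule absolutely_continuous_fun_on_shift) (use \<tau> in auto)
next
  have "AE t in lebesgue_on {0..}. (x has_vector_derivative f (x t) (u t)) (at t within {0..})"
    using x by (simp add: state_trajectory_def)
  then have "AE s in lebesgue_on {0..}.
      (x has_vector_derivative f (x (\<tau> + s)) (u (\<tau> + s))) (at (\<tau> + s) within {0..})"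
    by (rule AE_lebesgue_on_translate) (use \<tau> in auto)
  moreover have "AE s in lebesgue_on {0::real..}. s \<in> {0..}"
    by (intro AE_I2) simp
  ultimately show "AE s in lebesgue_on {0..}. ((\<lambda>s. x (\<tau> + s)) has_vector_derivative
      f (x (\<tau> + s)) (v s)) (at s within {0..})"
  proof eventually_elim
    case (elim s)
    \<comment> \<open>The chain rule needs the derivative within the image of the half-line under
      the shift, which lies inside \<open>{0..}\<close> as \<tau> is nonnegative.\<close>
    have "(x has_vector_derivative f (x (\<tau> + s)) (u (\<tau> + s))) (at (\<tau> + s) within (+) \<tau> ` {0..})"
      using elim(1) by (rule has_vector_derivative_within_subset) (use \<tau> in auto)
    moreover have "((+) \<tau> has_vector_derivative 1) (at s within {0..})"
      by (auto intro!: derivative_eq_intros)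
    ultimately have "(x \<circ> (+) \<tau> has_vector_derivative 1 *\<^sub>R f (x (\<tau> + s)) (u (\<tau> + s)))
        (at s within {0..})"
      by (intro vector_diff_chain_within)
    then show ?case
      using v elim(2) by (simp add: o_def)
  qed
qed

subsection \<open>Fading memory\<close>

lemma input_difference_measurable:
  assumes "ua \<in> L_infinity" "ub \<in> L_infinity"
  shows "(\<lambda>s. norm (ua s - ub s)) \<in> borel_measurable (lebesgue_on {0..t})"
proof -
  have "(\<lambda>s. norm (ua s - ub s)) \<in> borel_measurable (lebesgue_on {0..})"
    using assms by (auto simp: L_infinity_def)
  then show ?thesis
    by (rule measurable_restrict_mono) auto
qed

text \<open>An input difference of age at most \<open>h\<close> carries weight at least
  \<open>exp (- h)\<close> in \<open>V\<close>. If that weight is at least \<open>sqrt V\<close>,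
  the difference is at most \<open>V / sqrt V = sqrt V\<close>. The hypothesis \<open>bound\<close>
  keeps the weighted supremum finite.\<close>

lemma ess_sup_on_recent_le_sqrt:
  fixes ua ub :: "real \<Rightarrow> real ^ 'm"
  assumes ua: "ua \<in> L_infinity" and ub: "ub \<in> L_infinity"
    and va: "va \<in> L_infinity" and vb: "vb \<in> L_infinity"
    and bound: "\<And>s. 0 \<le> s \<Longrightarrow> norm (ua s - ub s) \<le> c"
    and h: "0 \<le> h" "h \<le> t"
    and va_eq: "\<And>s. 0 \<le> s \<Longrightarrow> va s = ua (t - h + s)"
    and vb_eq: "\<And>s. 0 \<le> s \<Longrightarrow> vb s = ub (t - h + s)"
    and V_def: "V = ess_sup_on {0..t} (\<lambda>s. exp (- (t - s)) * norm (ua s - ub s))"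
    and depth: "h = 0 \<or> sqrt V \<le> exp (- h)"
  shows "ess_sup_on {0..h} (\<lambda>s. norm (va s - vb s)) \<le> sqrt V"
proof (rule ess_sup_on_le[OF input_difference_measurable[OF va vb]])
  have V: "0 \<le> V" by (simp add: V_def ess_sup_on_nonneg)
  then show "0 \<le> sqrt V" by simp
  show "AE s in lebesgue_on {0..h}. norm (va s - vb s) \<le> sqrt V"
  proof (cases "h = 0")
    case True
    \<comment> \<open>The window is a single point, hence null, and the almost-everywhere claim is
      vacuous.\<close>
    have "{0::real} \<in> null_sets lebesgue" by simp
    then have "AE s in lebesgue. s \<notin> {0::real}"
      by (rule AE_not_in)
    then have "AE s in lebesgue. s \<in> {0..h} \<longrightarrow> norm (va s - vb s) \<le> sqrt V"
      by eventually_elim (use True in auto)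
    then show ?thesis by (simp add: AE_restrict_space_iff)
  next
    case False
    then have dep: "sqrt V \<le> exp (- h)" using depth by simp
    let ?g = "\<lambda>s. exp (- (t - s)) * norm (ua s - ub s)"
    have "(\<lambda>s. exp (- (t - s))) \<in> borel_measurable (lebesgue_on {0..t})"
      by (intro measurable_restrict_space1 measurable_completion) simp
    then have meas: "?g \<in> borel_measurable (lebesgue_on {0..t})"
      using input_difference_measurable[OF ua ub] by (rule borel_measurable_times)
    have "AE s in lebesgue_on {0..t}. ?g s \<le> c"
    proof (rule AE_I2)
      fix s assume "s \<in> space (lebesgue_on {0..t})"
      then have s: "0 \<le> s" "s \<le> t" by auto
      have "?g s \<le> 1 * norm (ua s - ub s)"
        using s by (intro mult_right_mono) auto
      then show "?g s \<le> c" using bound[OF s(1)] by simp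
    qed
    then have "AE s in lebesgue_on {0..t}. ?g s \<le> V"
      unfolding V_def by (rule AE_le_ess_sup_on[OF meas])
    then have "AE s in lebesgue_on {0..h}. ?g (t - h + s) \<le> V"
      by (rule AE_lebesgue_on_translate) (use h in auto)
    moreover have "AE s in lebesgue_on {0..h}. s \<in> {0..h}"
      by (intro AE_I2) simp
    ultimately show ?thesis
    proof eventually_elim
      case (elim s)
      let ?d = "norm (va s - vb s)"
      \<comment> \<open>The age of the restarted time \<open>s\<close> is \<open>h - s\<close>,
        which is at most \<open>h\<close>.\<close>
      have "exp (- h) * ?d \<le> exp (- (t - (t - h + s))) * ?d"
        using elim(2) by (intro mult_right_mono) auto
      also have "\<dots> \<le> V" using elim va_eq vb_eq by simp
      finally have *: "exp (- h) * ?d \<le> V" .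
      show "?d \<le> sqrt V"
      \<comment> \<open>Cancelling \<open>sqrt V\<close> requires \<open>V > 0\<close>; for
        \<open>V = 0\<close> the positive factor \<open>exp (- h)\<close> forces the difference to
        vanish.\<close>
      proof (cases "V = 0")
        case True
        then have "exp (- h) * ?d \<le> 0" using * by simp
        then have "?d \<le> 0" by (simp add: mult_le_0_iff)
        then show ?thesis using True by simp
      next
        case False
        have "sqrt V * ?d \<le> exp (- h) * ?d" using dep by (intro mult_right_mono) auto
        then have "sqrt V * ?d \<le> sqrt V * sqrt V" using * V by simp
        moreover have "0 < sqrt V" using False V by simp
        ultimately show ?thesis by (rule mult_left_le_imp_le)
      qed
    qed
  qed
qed

theorem theorem4:
  fixes f :: "real ^ 'n \<Rightarrow> real ^ 'm \<Rightarrow> real ^ 'n"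
    and U :: "(real \<Rightarrow> real ^ 'm) set"
    and X0 :: "(real ^ 'n) set"
  assumes inputs: "U \<subseteq> L_infinity"
    and time_invariant_inputs: "shift_closed U"
    and complete: "forward_complete f U"
    and compact_X0: "compact X0"
    and equibounded: "\<exists>M>0. \<forall>u\<in>U. \<forall>t\<ge>0. norm (u t) \<le> M"
    and delta_ISS: "globally_delta_ISS f U"
  shows "input_to_state_FM f U X0"
proof -
  obtain M where M: "M > 0" "\<And>u t. u \<in> U \<Longrightarrow> 0 \<le> t \<Longrightarrow> norm (u t) \<le> M"
    using equibounded by blast
  obtain \<beta> \<gamma> where \<beta>: "class_KL \<beta>" and \<gamma>: "class_K_infinity \<gamma>" and
    iss': "\<forall>ua\<in>U. \<forall>ub\<in>U. \<forall>xa xb.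
      state_trajectory f ua xa \<and> state_trajectory f ub xb \<and> xa 0 \<in> UNIV \<and> xb 0 \<in> UNIV \<longrightarrow>
      (\<forall>t\<ge>0. norm (xa t - xb t)
        \<le> \<beta> (norm (xa 0 - xb 0)) t + \<gamma> (ess_sup_on {0..t} (\<lambda>s. norm (ua s - ub s))))"
    using delta_ISS unfolding globally_delta_ISS_def delta_ISS_def by (elim exE conjE) (rule that)
  have iss: "norm (xa t - xb t)
      \<le> \<beta> (norm (xa 0 - xb 0)) t + \<gamma> (ess_sup_on {0..t} (\<lambda>s. norm (ua s - ub s)))"
    if "ua \<in> U" "ub \<in> U" "state_trajectory f ua xa" "state_trajectory f ub xb" "0 \<le> t"
    for ua ub xa xb t
    using iss' that by simp
  have K: "class_K \<gamma>" using \<gamma> by (simp add: class_K_infinity_def)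
  obtain D where D: "0 \<le> D" "\<And>x y. x \<in> X0 \<Longrightarrow> y \<in> X0 \<Longrightarrow> norm (x - y) \<le> D"
    using diameter_bounded_bound[OF compact_imp_bounded[OF compact_X0]]
      diameter_ge_0[OF compact_imp_bounded[OF compact_X0]]
    by (metis dist_norm)
  \<comment> \<open>A bound on the state difference at all times: initial states differ by at most
    \<open>D\<close>, inputs by at most \<open>2 * M\<close>, and \<beta> is largest at time
    0.\<close>
  define R where "R = \<beta> D 0 + \<gamma> (2 * M)"
  have R: "0 \<le> R"
    using class_KL_nonneg[OF \<beta> D(1)] class_K_nonneg[OF K, of "2 * M"] M(1) by (simp add: R_def)
  have diff_bound: "norm (ua s - ub s) \<le> 2 * M" if "ua \<in> U" "ub \<in> U" "0 \<le> s" for ua ub s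
    using norm_triangle_ineq4[of "ua s" "ub s"] M(2)[OF that(1,3)] M(2)[OF that(2,3)] by linarith
  define g where "g v = (if v = 0 then 0 else \<beta> R (max 0 (- ln v / 2)))" for v
  have main: "norm (xa t - xb t) \<le> \<beta> (norm (xa 0 - xb 0)) t
      + (\<gamma> (sqrt V) + g V)"
    if U: "ua \<in> U" "ub \<in> U" and tr: "state_trajectory f ua xa" "state_trajectory f ub xb"
      and X0: "xa 0 \<in> X0" "xb 0 \<in> X0" and t: "0 \<le> t"
      and V_def: "V = ess_sup_on {0..t} (\<lambda>s. exp (- (t - s)) * norm (ua s - ub s))"
    for ua ub xa xb t V
  proof -
    have V: "0 \<le> V" by (simp add: V_def ess_sup_on_nonneg)
    have R_bound: "norm (xa s - xb s) \<le> R" if s: "0 \<le> s" for s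
    proof -
      have "ess_sup_on {0..s} (\<lambda>s. norm (ua s - ub s)) \<le> 2 * M"
        using U inputs M(1) diff_bound[OF U]
        by (intro ess_sup_on_le input_difference_measurable AE_I2) auto
      then have "\<gamma> (ess_sup_on {0..s} (\<lambda>s. norm (ua s - ub s))) \<le> \<gamma> (2 * M)"
        by (rule class_K_mono[OF K ess_sup_on_nonneg])
      moreover have "\<beta> (norm (xa 0 - xb 0)) s \<le> \<beta> D s"
        using D(2)[OF X0] s by (intro class_KL_mono[OF \<beta>]) auto
      moreover have "\<beta> D s \<le> \<beta> D 0"
        using s D(1) by (intro class_KL_antimono[OF \<beta>]) auto
      ultimately show ?thesis
        using iss[OF U tr s] by (simp add: R_def)
    qed
    \<comment> \<open>Here the stability must be global: the states at time \<open>t - h\<close>,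
      which become initial conditions, may lie outside \<open>X0\<close>.\<close>
    have restart: "norm (xa t - xb t) \<le> \<beta> (norm (xa (t - h) - xb (t - h))) h + \<gamma> (sqrt V)"
      if h: "0 \<le> h" "h \<le> t" and depth: "h = 0 \<or> sqrt V \<le> exp (- h)" for h
    proof -
      obtain va where va: "va \<in> U" "\<And>s. 0 \<le> s \<Longrightarrow> va s = ua (t - h + s)"
        using time_invariant_inputs U(1) h(2) unfolding shift_closed_def by (metis diff_ge_0_iff_ge)
      obtain vb where vb: "vb \<in> U" "\<And>s. 0 \<le> s \<Longrightarrow> vb s = ub (t - h + s)"
        using time_invariant_inputs U(2) h(2) unfolding shift_closed_def by (metis diff_ge_0_iff_ge)
      have "state_trajectory f va (\<lambda>s. xa (t - h + s))" "state_trajectory f vb (\<lambda>s. xb (t - h + s))"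
        using state_trajectory_shift[OF tr(1) _ va(2)] state_trajectory_shift[OF tr(2) _ vb(2)] h(2)
        by auto
      from iss[OF va(1) vb(1) this h(1)]
      have "norm (xa t - xb t) \<le> \<beta> (norm (xa (t - h) - xb (t - h))) h
          + \<gamma> (ess_sup_on {0..h} (\<lambda>s. norm (va s - vb s)))"
        by simp
      moreover have "ess_sup_on {0..h} (\<lambda>s. norm (va s - vb s)) \<le> sqrt V"
        by (rule ess_sup_on_recent_le_sqrt[OF _ _ _ _ diff_bound[OF U] h va(2) vb(2) V_def depth])
          (use inputs U va(1) vb(1) in auto)
      ultimately show ?thesis
        using class_K_mono[OF K ess_sup_on_nonneg] by (meson add_left_mono order_trans)
    qed
    have \<beta>_nonneg: "0 \<le> \<beta> (norm (xa 0 - xb 0)) t"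
      using t by (intro class_KL_nonneg[OF \<beta>]) auto
    have g_nonneg: "0 \<le> g V"
      using class_KL_nonneg[OF \<beta> R] by (simp add: g_def)
    show ?thesis
    \<comment> \<open>In the first case the restart is at time 0, which keeps the term in the
      initial states. In the second that term is discarded as nonnegative, and everything before
      \<open>t - h\<close> enters through \<open>R\<close>.\<close>
    proof (cases "sqrt V \<le> exp (- t)")
      case True
      then show ?thesis using restart[of t] t g_nonneg by simp
    next
      case False
      then have "V > 0" using V by (cases "V = 0") auto
      \<comment> \<open>The solution of \<open>exp (- h) = sqrt V\<close>, truncated at 0 when
        \<open>V > 1\<close>.\<close>
      define h where "h = max 0 (- ln V / 2)"
      have exp_half: "exp (ln V / 2) = sqrt V"
        using \<open>V > 0\<close> by (simp add: ln_sqrt[symmetric])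
      \<comment> \<open>The failed case condition says precisely that \<open>- ln V / 2 < t\<close>,
        so the restart time \<open>t - h\<close> is nonnegative.\<close>
      then have "exp (- t) < exp (ln V / 2)" using False by simp
      then have "h \<le> t" using t by (simp add: h_def)
      moreover have "h = 0 \<or> sqrt V \<le> exp (- h)"
        using exp_half by (auto simp: h_def max_def)
      moreover have "0 \<le> h" by (simp add: h_def)
      ultimately have "norm (xa t - xb t) \<le> \<beta> (norm (xa (t - h) - xb (t - h))) h + \<gamma> (sqrt V)"
        and "\<beta> (norm (xa (t - h) - xb (t - h))) h \<le> \<beta> R h"
        using restart[of h] R_bound[of "t - h"] by (auto intro: class_KL_mono[OF \<beta>])
      moreover have "g V = \<beta> R h" using \<open>V > 0\<close> by (simp add: g_def h_def)
      ultimately show ?thesis using \<beta>_nonneg by linarith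
    qed
  qed
  have "class_K_infinity (\<lambda>v. \<gamma> (sqrt v) + g v)"
    unfolding g_def by (rule class_K_infinity_sqrt_plus_KL[OF \<gamma> \<beta> R])
  then show ?thesis
    unfolding input_to_state_FM_def
    using \<beta> memory_kernel_exp main[OF _ _ _ _ _ _ _ refl]
    by (intro exI[of _ \<beta>] exI[of _ "\<lambda>v. \<gamma> (sqrt v) + g v"] exI[of _ "\<lambda>h. exp (- h)"]) simp
qed

end
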